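(* Let $L>0$, let $m,n$ be continuous functions on $[0,L]$, bounded below by some positive constant, and let $c\in(0,L)$. Then for any fixed $t>0$, $$N(\lambda,t,(0,L))=N(\lambda,t,(0,c))+N(\lambda,t,(c,L))+O(1)\qquad\text{as }\lambda\to\infty.$$
   Context: For a function $u$, $u^\pm=\max\{0,\pm u\}$. For an interval $(a,b)\subset(0,L)$ and $t>0$, consider the eigenvalue problem $$-u''=\lambda\big(m(x)u^+-t\,n(x)u^-\big)\ \text{ in }(a,b),\qquad u(a)=u(b)=0.$$ Its spectrum is a double sequence $\{\lambda_{k,t}^\pm(a,b)\}_{k\ge1}$, where for each $k\ge 1$, $\lambda_{k,t}^+(a,b)$ (resp. $\lambda_{k,t}^-(a,b)$) is the unique $\lambda>0$ for which the problem has a nontrivial solution with exactly $k$ nodal domains in $(a,b)$ (i.e. $k+1$ zeros in $[a,b]$) and $u'(a)>0$ (resp. $u'(a)<0$). The spectral counting function is $$N(\lambda,t,(a,b))=\#\{k:\lambda_{k,t}^+(a,b)\le\lambda\}+\#\{k:\lambda_{k,t}^-(a,b)\le\lambda\}.$$ *)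

theory Defs
  imports "HOL-Analysis.Analysis" "HOL-Library.Landau_Symbols"
begin

text \<open>
  Classical solutions of \<open>-u'' = l (m u\<^sup>+ - t n u\<^sup>-)\<close> in \<open>(a,b)\<close> with
  \<open>u(a) = u(b) = 0\<close>. The function \<open>du\<close> is the derivative of \<open>u\<close>, one-sided at the end points,
  which gives a meaning to \<open>u'(a)\<close>.
\<close>

definition bvp_solution ::
  "(real \<Rightarrow> real) \<Rightarrow> (real \<Rightarrow> real) \<Rightarrow> real \<Rightarrow> real \<Rightarrow> real \<Rightarrow> real \<Rightarrow> (real \<Rightarrow> real) \<Rightarrow> (real \<Rightarrow> real) \<Rightarrow> bool"
where
  "bvp_solution m n t l a b u du \<longleftrightarrow>
     (\<forall>x\<in>{a..b}. (u has_real_derivative du x) (at x within {a..b})) \<and>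
     continuous_on {a..b} du \<and>
     (\<forall>x\<in>{a<..<b}.
        (du has_real_derivative - (l * (m x * max 0 (u x) - t * n x * max 0 (- u x)))) (at x)) \<and>
     u a = 0 \<and> u b = 0"

definition nodal_domains :: "real \<Rightarrow> real \<Rightarrow> (real \<Rightarrow> real) \<Rightarrow> real set set" where
  "nodal_domains a b u = components {x \<in> {a<..<b}. u x \<noteq> 0}"

text \<open>
  The half-eigenvalues are only meaningful for \<open>k \<ge> 1\<close>; in that case \<open>card \<dots> = k\<close> includes
  finiteness of the set of nodal domains.
\<close>

definition eigval_pos ::
  "(real \<Rightarrow> real) \<Rightarrow> (real \<Rightarrow> real) \<Rightarrow> real \<Rightarrow> real \<Rightarrow> real \<Rightarrow> nat \<Rightarrow> real"
where
  "eigval_pos m n t a b k =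
     (THE l. l > 0 \<and> (\<exists>u du. bvp_solution m n t l a b u du \<and> (\<exists>x\<in>{a..b}. u x \<noteq> 0) \<and>
                card (nodal_domains a b u) = k \<and> du a > 0))"

definition eigval_neg ::
  "(real \<Rightarrow> real) \<Rightarrow> (real \<Rightarrow> real) \<Rightarrow> real \<Rightarrow> real \<Rightarrow> real \<Rightarrow> nat \<Rightarrow> real"
where
  "eigval_neg m n t a b k =
     (THE l. l > 0 \<and> (\<exists>u du. bvp_solution m n t l a b u du \<and> (\<exists>x\<in>{a..b}. u x \<noteq> 0) \<and>
                card (nodal_domains a b u) = k \<and> du a < 0))"

definition spectral_count ::
  "(real \<Rightarrow> real) \<Rightarrow> (real \<Rightarrow> real) \<Rightarrow> real \<Rightarrow> real \<Rightarrow> real \<Rightarrow> real \<Rightarrow> nat"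
where
  "spectral_count m n l t a b =
     card {k. 1 \<le> k \<and> eigval_pos m n t a b k \<le> l} +
     card {k. 1 \<le> k \<and> eigval_neg m n t a b k \<le> l}"

end

theory Submission
  imports Defs
begin

text \<open>
  The counting function is read off from a rotation angle. For $\lambda = s^2$ write a solution in
  scaled polar coordinates, $u = r \sin\theta$ and $u' = s\,r\cos\theta$. Positive homogeneity of
  $f(x,v) = m(x) v^+ - t\,n(x) v^-$ decouples the angle from the amplitude:
  $$\theta' = s\,\Phi(x,\theta), \qquad \Phi(x,\theta) = \cos^2\theta + \sin\theta\, f(x,\sin\theta).$$
  The factor $s$ in $u'$ is what makes this form convenient: the spectral parameter appears only as
  the speed with which the vector field \<open>\<Phi>\<close> is followed, and \<open>\<Phi>\<close> is Lipschitz in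
  $\theta$, periodic with period $2\pi$, and bounded below by a positive constant.

  Zeros of $u$ are the passages of $\theta$ through multiples of $\pi$, and $\theta$ increases
  strictly, so a solution with $\theta(a) = y$, where $y = 0$ or $y = \pi$ according to the sign of
  $u'(a)$, is an eigenfunction with $k$ nodal domains exactly if $\theta(b) = y + k\pi$
  (\<open>half_eigenfunction_iff\<close>). The final angle $\theta(b)$ depends continuously and strictly
  monotonically on $s$, equals $y$ for $s = 0$ and tends to infinity with $s$. This gives existence
  and uniqueness of the half-eigenvalues, and shows that the $k$-th of them is at most $\lambda$
  exactly if $k\pi \le \theta(b) - y$ for $s = \sqrt\lambda$ (\<open>half_eigenvalue_le_iff\<close>).
  Hence $N(\lambda,t,(a,b))$ is a sum of two terms $\lfloor(\theta(b)-y)/\pi\rfloor$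
  (\<open>spectral_count_eq\<close>).

  Angles add up along an interval. The angle coming from $(0,c)$ need not enter $(c,L)$ with the
  value $y$, but there it lies between two translates by multiples of $2\pi$ of the angle that does; order preservation
  of a scalar flow and periodicity keep it there. So cutting at $c$ changes the total angle by at
  most $2\pi$, whatever $\lambda$ is (\<open>half_turns_additive\<close>).

  The analytic basis is the theorem of Picard and Lindeloef for scalar equations and one comparison
  lemma, from which order preservation and the dependence on $s$ follow by choosing suitable barriers.
\<close>

section \<open>Scalar ordinary differential equations on a compact interval\<close>

text \<open>
  Picard--Lindeloef on the whole interval at once: substituting $\theta = e^{C(x-a)} g$ with
  $C = 2K$, i.e. using a weighted supremum norm, makes the Picard operator a contraction
  regardless of the length of the interval, so no gluing of short-time solutions is needed.
  Continuity of $F$ is asked for only through the superposition operator $g \mapsto F(\cdot,g)$.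
\<close>
lemma lipschitz_ode_solution_exists:
  fixes F :: "real \<Rightarrow> real \<Rightarrow> real"
  assumes ab: "a < b" and K: "0 < K"
    and cont: "\<And>g. continuous_on {a..b} g \<Longrightarrow> continuous_on {a..b} (\<lambda>x. F x (g x))"
    and lip: "\<And>x y z. x \<in> {a..b} \<Longrightarrow> \<bar>F x y - F x z\<bar> \<le> K * \<bar>y - z\<bar>"
  shows "\<exists>\<theta>. \<theta> a = y0 \<and>
           (\<forall>x\<in>{a..b}. (\<theta> has_real_derivative F x (\<theta> x)) (at x within {a..b}))"
proof -
  define C where "C = 2 * K"
  have C: "C > 0" using K by (simp add: C_def)
  define e where "e = (\<lambda>x. exp (C * (x - a)))"
  have e_pos: "e x > 0" for x by (simp add: e_def)
  have e_cont: "continuous_on S e" for S by (auto simp: e_def intro!: continuous_intros)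
  define G where "G = (\<lambda>g. \<lambda>x. y0 + integral {a..x} (\<lambda>s. F s (e s * g s)))"
  \<comment> \<open>Clamping to the interval makes the operator act on bounded continuous functions on the
    whole line, which form a complete metric space.\<close>
  define p where "p = (\<lambda>x. max a (min b x))"
  have p_in: "p x \<in> {a..b}" for x using ab by (auto simp: p_def)
  have p_id: "p x = x" if "x \<in> {a..b}" for x using that by (auto simp: p_def)
  have p_cont: "continuous_on UNIV p" by (auto simp: p_def intro!: continuous_intros)
  have int_cont: "continuous_on {a..b} (\<lambda>s. F s (e s * g s))"
    if "continuous_on {a..b} g" for g
    by (rule cont[of "\<lambda>s. e s * g s"]) (intro continuous_on_mult e_cont that)
  have G_deriv: "(G g has_real_derivative F x (e x * g x)) (at x within {a..b})"
    if "continuous_on {a..b} g" "x \<in> {a..b}" for g x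
    unfolding G_def using integral_has_real_derivative[OF int_cont[OF that(1)] that(2)]
    by (auto intro!: derivative_eq_intros)
  have G_cont: "continuous_on {a..b} (G g)" if "continuous_on {a..b} g" for g
    using G_deriv[OF that] by (rule DERIV_continuous_on)
  define H where "H = (\<lambda>g x. G g x / e x)"
  have H_cont: "continuous_on {a..b} (H g)" if "continuous_on {a..b} g" for g
    unfolding H_def using e_pos by (intro continuous_on_divide G_cont e_cont that) (auto simp: less_imp_neq[symmetric])
  have H_bc: "(\<lambda>x. H g (p x)) \<in> bcontfun" if "continuous_on {a..b} g" for g
  proof -
    have "compact (H g ` {a..b})" by (intro compact_continuous_image H_cont that) auto
    then have "bounded (H g ` {a..b})" by (rule compact_imp_bounded)
    then have "bounded (range (\<lambda>x. H g (p x)))"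
      by (rule bounded_subset) (use p_in in auto)
    moreover have "continuous_on UNIV (\<lambda>x. H g (p x))"
      by (rule continuous_on_compose2[OF H_cont[OF that] p_cont]) (use p_in in auto)
    ultimately show ?thesis by (simp add: bcontfun_def)
  qed
  define T :: "(real \<Rightarrow>\<^sub>C real) \<Rightarrow> (real \<Rightarrow>\<^sub>C real)"
    where "T = (\<lambda>g. Bcontfun (\<lambda>x. H (apply_bcontfun g) (p x)))"
  have T_apply: "apply_bcontfun (T g) x = H (apply_bcontfun g) (p x)" for g x
    unfolding T_def by (subst Bcontfun_inverse) (auto intro!: H_bc)
  have contraction: "dist (T g) (T h) \<le> 1/2 * dist g h" for g h
  proof (rule dist_bound)
    fix x0
    define x where "x = p x0"
    have x: "x \<in> {a..b}" using p_in by (simp add: x_def)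
    define D where "D = dist g h"
    have D0: "D \<ge> 0" by (simp add: D_def)
    have sub: "{a..x} \<subseteq> {a..b}" using x by auto
    have ig: "(\<lambda>s. F s (e s * g s)) integrable_on {a..x}"
      and ih: "(\<lambda>s. F s (e s * h s)) integrable_on {a..x}"
      by (auto intro!: integrable_continuous_interval continuous_on_subset[OF int_cont sub])
    have der: "((\<lambda>s. e s * (D / 2)) has_real_derivative K * (e s * D)) (at s within {a..x})" for s
      unfolding e_def C_def by (auto intro!: derivative_eq_intros)
    have ftc: "((\<lambda>s. K * (e s * D)) has_integral (e x * (D / 2) - e a * (D / 2))) {a..x}"
      by (rule fundamental_theorem_of_calculus)
         (use x der in \<open>auto simp: has_real_derivative_iff_has_vector_derivative[symmetric]\<close>)
    have "norm (integral {a..x} (\<lambda>s. F s (e s * g s) - F s (e s * h s)))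
            \<le> integral {a..x} (\<lambda>s. K * (e s * D))"
    proof (rule integral_norm_bound_integral)
      show "(\<lambda>s. F s (e s * g s) - F s (e s * h s)) integrable_on {a..x}"
        using ig ih by (rule integrable_diff)
      show "(\<lambda>s. K * (e s * D)) integrable_on {a..x}" using ftc by blast
      fix s assume s: "s \<in> {a..x}"
      have "\<bar>F s (e s * g s) - F s (e s * h s)\<bar> \<le> K * \<bar>e s * g s - e s * h s\<bar>"
        using s sub by (intro lip) auto
      also have "\<bar>e s * g s - e s * h s\<bar> = e s * \<bar>g s - h s\<bar>"
        using e_pos[of s] by (simp add: right_diff_distrib[symmetric] abs_mult)
      also have "\<bar>g s - h s\<bar> \<le> D"
        using dist_bounded[of g s h] by (simp add: D_def dist_real_def)
      finally show "norm (F s (e s * g s) - F s (e s * h s)) \<le> K * (e s * D)"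
        using K e_pos[of s] by simp
    qed
    also have "\<dots> = e x * (D / 2) - e a * (D / 2)" using ftc by (rule integral_unique)
    also have "\<dots> \<le> e x * (D / 2)" using D0 e_pos[of a] by simp
    finally have "\<bar>G g x - G h x\<bar> \<le> e x * (D / 2)"
      using ig ih by (simp add: G_def integral_diff)
    moreover have "\<bar>H g x - H h x\<bar> = \<bar>G g x - G h x\<bar> / e x"
      using e_pos[of x] by (simp add: H_def diff_divide_distrib[symmetric])
    ultimately have "\<bar>H g x - H h x\<bar> \<le> D / 2"
      using e_pos[of x] by (simp add: divide_le_eq mult.commute)
    then show "dist (T g x0) (T h x0) \<le> 1/2 * dist g h"
      by (simp add: T_apply dist_real_def x_def D_def)
  qed
  obtain g where g: "T g = g"
    using banach_fix_type[of "1/2" T] contraction by (auto simp del: times_divide_eq_left)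
  have g_eq: "e x * g x = G g x" if "x \<in> {a..b}" for x
    using T_apply[of g x] g p_id[OF that] e_pos[of x] by (simp add: H_def)
  have "((\<lambda>x. G g x) has_real_derivative F x (G g x)) (at x within {a..b})"
    if "x \<in> {a..b}" for x
    using G_deriv[of "apply_bcontfun g" x] g_eq[OF that] that by simp
  moreover have "G g a = y0" by (simp add: G_def)
  ultimately show ?thesis by blast
qed

text \<open>
  A one-sided Gronwall argument. Only a growth bound at the points where the order is violated is
  required; this lets the same lemma serve for two solutions of one equation and for barriers built
  from a solution of another.
\<close>
lemma differential_inequality_comparison:
  fixes p q :: "real \<Rightarrow> real"
  assumes dp: "\<And>x. x \<in> {a..b} \<Longrightarrow> (p has_real_derivative p' x) (at x within {a..b})"
    and dq: "\<And>x. x \<in> {a..b} \<Longrightarrow> (q has_real_derivative q' x) (at x within {a..b})"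
    and growth: "\<And>x. x \<in> {a..b} \<Longrightarrow> q x < p x \<Longrightarrow> p' x - q' x \<le> K * (p x - q x)"
    and init: "p a \<le> q a" and x: "x \<in> {a..b}"
  shows "p x \<le> q x"
proof (rule ccontr)
  assume "\<not> p x \<le> q x"
  then have neg: "q x < p x" by simp
  define w where "w = (\<lambda>y. p y - q y)"
  have dw: "(w has_real_derivative p' y - q' y) (at y within {a..b})" if "y \<in> {a..b}" for y
    unfolding w_def by (intro DERIV_diff dp dq that)
  have w_cont: "continuous_on {a..b} w"
    using dw by (rule DERIV_continuous_on)
  define S where "S = {y \<in> {a..x}. w y \<le> 0}"
  have sub: "{a..x} \<subseteq> {a..b}" using x by auto
  have "closed S" unfolding S_def
    by (rule continuous_on_closed_Collect_le) (auto intro: continuous_on_subset[OF w_cont sub])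
  moreover have "bounded S" by (rule bounded_subset[of "{a..x}"]) (auto simp: S_def)
  ultimately have "compact S" by (simp add: compact_eq_bounded_closed)
  moreover have "a \<in> S" using init x by (auto simp: S_def w_def)
  \<comment> \<open>After the last point $s$ before $x$ with $p \le q$, the function $e^{-Ky}(p-q)$ decreases.\<close>
  ultimately obtain s where s: "s \<in> S" and smax: "\<And>y. y \<in> S \<Longrightarrow> y \<le> s"
    using compact_attains_sup[of S] by auto
  have sx: "a \<le> s" "s < x" "w s \<le> 0"
    using s neg by (auto simp: S_def w_def order.strict_iff_order)
  have pos: "w y > 0" if "s < y" "y \<le> x" for y
    using smax[of y] that sx by (force simp: S_def)
  have "exp (- K * x) * w x \<le> exp (- K * s) * w s"
  proof (rule DERIV_nonpos_imp_decreasing_open[where f = "\<lambda>y. exp (- K * y) * w y"])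
    show "s \<le> x" using sx by simp
    show "continuous_on {s..x} (\<lambda>y. exp (- K * y) * w y)"
      by (intro continuous_intros continuous_on_subset[OF w_cont]) (use sx x in auto)
    fix y assume y: "s < y" "y < x"
    then have yab: "a < y" "y < b" using sx x by auto
    then have "(w has_real_derivative p' y - q' y) (at y)"
      using dw[of y] by (simp add: at_within_Icc_at)
    then have "((\<lambda>y. exp (- K * y) * w y) has_real_derivative
        exp (- K * y) * (p' y - q' y - K * w y)) (at y)"
      by (auto intro!: derivative_eq_intros simp: algebra_simps)
    moreover have "p' y - q' y - K * w y \<le> 0"
      using growth[of y] pos[of y] y yab by (simp add: w_def)
    ultimately show "\<exists>d. ((\<lambda>y. exp (- K * y) * w y) has_real_derivative d) (at y) \<and> d \<le> 0"
      by (meson exp_ge_zero mult_nonneg_nonpos)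
  qed
  also have "\<dots> \<le> 0" using sx by (simp add: mult_nonneg_nonpos)
  finally show False using neg by (simp add: w_def mult_le_0_iff)
qed

lemma abs_sin_diff_le: "\<bar>sin y - sin z\<bar> \<le> \<bar>y - z\<bar>" for y z :: real
proof -
  have "\<bar>sin y - sin z\<bar> = 2 * \<bar>sin ((y - z) / 2)\<bar> * \<bar>cos ((y + z) / 2)\<bar>"
    by (simp add: sin_diff_sin abs_mult)
  also have "\<dots> \<le> 2 * \<bar>(y - z) / 2\<bar> * 1"
    by (intro mult_mono abs_sin_x_le_abs_x) auto
  finally show ?thesis by simp
qed


text \<open>
  The nodal domains are the sets where the angle lies strictly between two consecutive multiples of
  $\pi$. These are open, connected, nonempty and disjoint, and such a decomposition is unique.
\<close>
lemma card_nodal_domains_angle: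
  fixes \<theta> u :: "real \<Rightarrow> real"
  assumes ab: "a < b" and cont: "continuous_on {a..b} \<theta>" and mono: "strict_mono_on {a..b} \<theta>"
    and init: "sin (\<theta> a) = 0" and final: "\<theta> b = \<theta> a + real k * pi"
    and zeros: "\<And>x. x \<in> {a..b} \<Longrightarrow> u x = 0 \<longleftrightarrow> sin (\<theta> x) = 0"
  shows "card (nodal_domains a b u) = k"
proof -
  define J where "J = (\<lambda>i. {x \<in> {a<..<b}. \<theta> x \<in> {\<theta> a + real i * pi<..<\<theta> a + real (Suc i) * pi}})"
  obtain j where j: "\<theta> a = of_int j * pi" using init by (auto simp: sin_zero_iff_int2)
  have lessD: "\<theta> x < \<theta> y" if "x \<in> {a..b}" "y \<in> {a..b}" "x < y" for x y
    using mono that by (auto simp: strict_mono_on_def)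
  have leD: "\<theta> x \<le> \<theta> y" if "x \<in> {a..b}" "y \<in> {a..b}" "x \<le> y" for x y
    using lessD[of x y] that by (cases "x = y") auto
  have disjoint: "i = i'" if "x \<in> J i" "x \<in> J i'" for x i i'
  proof (rule ccontr)
    have no: False if "x \<in> J i" "x \<in> J i'" "i < i'" for i i'
    proof -
      have "real (Suc i) * pi \<le> real i' * pi" using \<open>i < i'\<close> by (intro mult_right_mono) auto
      moreover have "\<theta> a + real i' * pi < \<theta> x" "\<theta> x < \<theta> a + real (Suc i) * pi"
        using that unfolding J_def by auto
      ultimately show False by linarith
    qed
    assume "i \<noteq> i'"
    then show False using no[of i i'] no[of i' i] that by (cases "i < i'") auto
  qed
  have J_open: "open (J i)" for i
  proof -
    have "J i = {a<..<b} \<inter> \<theta> -` {\<theta> a + real i * pi<..<\<theta> a + real (Suc i) * pi}"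
      by (auto simp: J_def)
    moreover have "open \<dots>"
      by (rule continuous_open_preimage) (auto intro: continuous_on_subset[OF cont])
    ultimately show ?thesis by simp
  qed
  have J_connected: "connected (J i)" for i
  proof -
    have "z \<in> J i" if "x \<in> J i" "y \<in> J i" "x \<le> z" "z \<le> y" for x y z
    proof -
      have ab_xy: "a < x" "x < b" "a < y" "y < b" using that(1,2) by (auto simp: J_def)
      then have "\<theta> x \<le> \<theta> z" "\<theta> z \<le> \<theta> y" using leD[of x z] leD[of z y] that(3,4) by auto
      then show ?thesis using that ab_xy by (simp add: J_def del: of_nat_Suc)
    qed
    then have "is_interval (J i)" unfolding is_interval_1 by blast
    then show ?thesis by (simp add: is_interval_connected_1)
  qed
  have J_nonempty: "J i \<noteq> {}" if "i < k" for i
  proof -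
    let ?v = "\<theta> a + (real i + 1/2) * pi"
    have vb: "?v < \<theta> b"
      unfolding final using that pi_gt_zero by (intro add_strict_left_mono mult_strict_right_mono) auto
    have va: "\<theta> a < ?v" using pi_gt_zero by (simp add: add_pos_pos)
    obtain x where x: "a \<le> x" "x \<le> b" "\<theta> x = ?v"
      using IVT'[of \<theta> a ?v b] va vb ab cont by auto
    then have "a < x" "x < b" using va vb by (auto simp: order.strict_iff_order)
    moreover have "\<theta> a + real i * pi < ?v" "?v < \<theta> a + real (Suc i) * pi"
      using pi_gt_zero by (auto simp: algebra_simps)
    ultimately have "x \<in> J i" using x by (auto simp: J_def)
    then show ?thesis by blast
  qed
  have "(\<Union>i<k. J i) = {x \<in> {a<..<b}. u x \<noteq> 0}"
  proof (intro equalityI subsetI)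
    fix x assume "x \<in> (\<Union>i<k. J i)"
    then obtain i where x: "x \<in> {a<..<b}"
      and th: "\<theta> a + real i * pi < \<theta> x" "\<theta> x < \<theta> a + real (Suc i) * pi"
      by (auto simp: J_def)
    have "sin (\<theta> x) \<noteq> 0"
    proof
      assume "sin (\<theta> x) = 0"
      then obtain l where l: "\<theta> x = of_int l * pi" by (auto simp: sin_zero_iff_int2)
      have "of_int (j + int i) * pi < of_int l * pi" "of_int l * pi < of_int (j + int i + 1) * pi"
        using th unfolding l j by (auto simp: algebra_simps)
      then have "j + int i < l" "l < j + int i + 1"
        using mult_less_cancel_right_pos[OF pi_gt_zero] of_int_less_iff by blast+
      then show False by simp
    qed
    then show "x \<in> {x \<in> {a<..<b}. u x \<noteq> 0}" using x zeros[of x] by auto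
  next
    fix x assume "x \<in> {x \<in> {a<..<b}. u x \<noteq> 0}"
    then have x: "a < x" "x < b" and nz: "sin (\<theta> x) \<noteq> 0" using zeros[of x] by auto
    define z where "z = (\<theta> x - \<theta> a) / pi"
    have th: "\<theta> x = \<theta> a + z * pi" by (simp add: z_def)
    have "\<theta> a < \<theta> x" "\<theta> x < \<theta> b" using x lessD by auto
    then have z: "0 < z" "z < real k" unfolding final th using pi_gt_zero by (simp_all add: zero_less_mult_iff)
    define i where "i = nat \<lfloor>z\<rfloor>"
    have i: "real i \<le> z" "z < real (Suc i)" using z by (auto simp: i_def) linarith+
    have "real i \<noteq> z"
    proof
      assume "real i = z"
      then have "\<theta> x = of_int (j + int i) * pi" using th j by (simp add: algebra_simps)
      then show False using nz sin_zero_iff_int2 by blast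
    qed
    then have "real i < z" using i by simp
    then have "\<theta> a + real i * pi < \<theta> x" "\<theta> x < \<theta> a + real (Suc i) * pi"
      unfolding th using i(2) pi_gt_zero mult_strict_right_mono[OF _ pi_gt_zero]
      by (auto simp del: of_nat_Suc)
    moreover have "i < k" using i z by linarith
    ultimately show "x \<in> (\<Union>i<k. J i)" using x by (auto simp: J_def)
  qed
  then have "components {x \<in> {a<..<b}. u x \<noteq> 0} = J ` {..<k}"
  proof (rule components_open_unique[rotated])
    show "pairwise disjnt (J ` {..<k})"
      unfolding pairwise_def disjnt_def using disjoint by blast
  qed (use J_open J_connected J_nonempty in auto)
  moreover have "inj_on J {..<k}"
    unfolding inj_on_def using disjoint J_nonempty by (metis all_not_in_conv lessThan_iff)
  ultimately show ?thesis by (simp add: nodal_domains_def card_image)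
qed

section \<open>The scaled Pruefer angle\<close>

text \<open>
  The two constants bound the weights \<open>m\<close> and \<open>t n\<close> from below and above. They are
  parameters, so that one choice serves an interval and all its subintervals.
\<close>

locale half_linear =
  fixes m n :: "real \<Rightarrow> real" and t a b \<kappa> K :: real
  assumes ab: "a < b"
    and cont_m: "continuous_on {a..b} m" and cont_n: "continuous_on {a..b} n"
    and kappa: "0 < \<kappa>" "\<kappa> \<le> 1"
    and K: "1 \<le> K"
    and lower: "\<And>x. x \<in> {a..b} \<Longrightarrow> \<kappa> \<le> m x" "\<And>x. x \<in> {a..b} \<Longrightarrow> \<kappa> \<le> t * n x"
    and upper: "\<And>x. x \<in> {a..b} \<Longrightarrow> m x \<le> K" "\<And>x. x \<in> {a..b} \<Longrightarrow> t * n x \<le> K"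
begin

definition force :: "real \<Rightarrow> real \<Rightarrow> real" where
  "force x v = m x * max 0 v - t * n x * max 0 (- v)"

definition speed :: "real \<Rightarrow> real \<Rightarrow> real" where
  "speed x y = (cos y)\<^sup>2 + sin y * force x (sin y)"

definition phase :: "real \<Rightarrow> (real \<Rightarrow> real) \<Rightarrow> bool" where
  "phase s \<theta> \<longleftrightarrow> (\<forall>x\<in>{a..b}. (\<theta> has_real_derivative s * speed x (\<theta> x)) (at x within {a..b}))"

lemma phaseD:
  assumes "phase s \<theta>" "x \<in> {a..b}"
  shows "(\<theta> has_real_derivative s * speed x (\<theta> x)) (at x within {a..b})"
  using assms by (simp add: phase_def)

lemma phase_continuous: "phase s \<theta> \<Longrightarrow> continuous_on {a..b} \<theta>"
  by (rule DERIV_continuous_on[OF phaseD])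

lemma force_nonneg: "0 \<le> v \<Longrightarrow> force x v = m x * v"
  and force_nonpos: "v \<le> 0 \<Longrightarrow> force x v = t * n x * v"
  by (auto simp: force_def max_def)

lemma force_scale: "0 \<le> r \<Longrightarrow> force x (r * v) = r * force x v"
  by (cases "0 \<le> v") (auto simp: force_nonneg force_nonpos mult_nonneg_nonpos)

lemma force_continuous:
  assumes "continuous_on {a..b} g"
  shows "continuous_on {a..b} (\<lambda>x. force x (g x))"
  unfolding force_def by (intro continuous_intros cont_m cont_n assms)

lemma force_lipschitz:
  assumes x: "x \<in> {a..b}"
  shows "\<bar>force x v - force x w\<bar> \<le> K * \<bar>v - w\<bar>"
proof -
  have mb: "0 \<le> m x" "m x \<le> K" and nb: "0 \<le> t * n x" "t * n x \<le> K"
    using lower[OF x] upper[OF x] kappa by auto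
  have *: "\<bar>force x v - force x w\<bar> \<le> K * \<bar>v - w\<bar>" if "w \<le> v" for v w
  proof -
    consider "0 \<le> w" | "v \<le> 0" | "w \<le> 0" "0 \<le> v" using \<open>w \<le> v\<close> by linarith
    then show ?thesis
    proof cases
      case 1
      then have "\<bar>force x v - force x w\<bar> = m x * (v - w)"
        using that mb by (simp add: force_nonneg right_diff_distrib[symmetric])
      also have "\<dots> \<le> K * (v - w)" using that mb by (intro mult_right_mono) auto
      finally show ?thesis using that by simp
    next
      case 2
      then have "\<bar>force x v - force x w\<bar> = (t * n x) * (v - w)"
        using that nb by (simp add: force_nonpos right_diff_distrib[symmetric])
      also have "\<dots> \<le> K * (v - w)" using that nb by (intro mult_right_mono) auto
      finally show ?thesis using that by simp
    next
      case 3
      have "0 \<le> m x * v" "m x * v \<le> K * v" "0 \<le> (t * n x) * (- w)" "(t * n x) * (- w) \<le> K * (- w)"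
        using 3 mb nb mult_right_mono[OF mb(2), of v] mult_right_mono[OF nb(2), of "- w"]
        by (auto simp: mult_nonneg_nonpos)
      moreover have "force x v = m x * v" "force x w = (t * n x) * w"
        using 3 by (simp_all add: force_nonneg force_nonpos)
      ultimately show ?thesis using that by (simp add: algebra_simps)
    qed
  qed
  show ?thesis using *[of v w] *[of w v] by (cases "v \<le> w") (auto simp: abs_minus_commute)
qed

lemma force_abs_le: "x \<in> {a..b} \<Longrightarrow> \<bar>force x v\<bar> \<le> K * \<bar>v\<bar>"
  using force_lipschitz[of x v 0] by (simp add: force_def)

lemma force_quadratic:
  assumes x: "x \<in> {a..b}"
  shows "\<kappa> * v\<^sup>2 \<le> v * force x v" "v * force x v \<le> K * v\<^sup>2"
proof -
  show "\<kappa> * v\<^sup>2 \<le> v * force x v"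
    using mult_right_mono[OF lower(1)[OF x], of "v\<^sup>2"] mult_right_mono[OF lower(2)[OF x], of "v\<^sup>2"]
    by (cases "0 \<le> v") (auto simp: force_nonneg force_nonpos power2_eq_square mult_ac)
  show "v * force x v \<le> K * v\<^sup>2"
    using mult_right_mono[OF upper(1)[OF x], of "v\<^sup>2"] mult_right_mono[OF upper(2)[OF x], of "v\<^sup>2"]
    by (cases "0 \<le> v") (auto simp: force_nonneg force_nonpos power2_eq_square mult_ac)
qed

lemma speed_bounds:
  assumes x: "x \<in> {a..b}"
  shows "\<kappa> \<le> speed x y" "speed x y \<le> K"
proof -
  have one: "(cos y)\<^sup>2 = 1 - (sin y)\<^sup>2" by (simp add: cos_squared_eq)
  have c0: "0 \<le> (cos y)\<^sup>2" by simp
  have "\<kappa> * (cos y)\<^sup>2 \<le> (cos y)\<^sup>2" "(cos y)\<^sup>2 \<le> K * (cos y)\<^sup>2"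
    using mult_right_mono[OF kappa(2) c0] mult_right_mono[OF K c0] by auto
  then show "\<kappa> \<le> speed x y" "speed x y \<le> K"
    using force_quadratic[OF x, of "sin y"] unfolding speed_def one
    by (auto simp: algebra_simps)
qed

text \<open>As $\cos^2 = 1 - \sin^2$, the speed is a Lipschitz function of $\sin\theta$ alone.\<close>
lemma speed_lipschitz:
  assumes x: "x \<in> {a..b}"
  shows "\<bar>speed x y - speed x z\<bar> \<le> 4 * K * \<bar>y - z\<bar>"
proof -
  let ?d = "\<bar>sin y - sin z\<bar>"
  have one: "(cos u)\<^sup>2 = 1 - (sin u)\<^sup>2" for u :: real by (simp add: cos_squared_eq)
  have "\<bar>(sin y)\<^sup>2 - (sin z)\<^sup>2\<bar> = \<bar>sin y + sin z\<bar> * ?d"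
    by (simp add: abs_mult[symmetric] power2_eq_square algebra_simps)
  also have "\<dots> \<le> 2 * ?d"
    using abs_sin_le_one[of y] abs_sin_le_one[of z]
    by (intro mult_right_mono order_trans[OF abs_triangle_ineq]) linarith+
  also have "\<dots> \<le> (2 * K) * ?d" using K by (intro mult_right_mono) auto
  finally have 1: "\<bar>(sin y)\<^sup>2 - (sin z)\<^sup>2\<bar> \<le> 2 * K * ?d" .
  have "\<bar>(sin y - sin z) * force x (sin y)\<bar> \<le> ?d * (K * 1)"
    unfolding abs_mult using force_abs_le[OF x, of "sin y"] K
    by (intro mult_left_mono order_trans[OF force_abs_le[OF x]]) auto
  moreover have "\<bar>sin z * (force x (sin y) - force x (sin z))\<bar> \<le> 1 * (K * ?d)"
    unfolding abs_mult using K by (intro mult_mono force_lipschitz[OF x]) auto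
  ultimately have 2: "\<bar>(sin y - sin z) * force x (sin y) + sin z * (force x (sin y) - force x (sin z))\<bar>
      \<le> 2 * K * ?d" by (auto simp: mult.commute)
  have "speed x y - speed x z = ((sin z)\<^sup>2 - (sin y)\<^sup>2) +
      ((sin y - sin z) * force x (sin y) + sin z * (force x (sin y) - force x (sin z)))"
    unfolding speed_def one by (simp add: algebra_simps)
  then have "\<bar>speed x y - speed x z\<bar> \<le> 4 * K * ?d" using 1 2 by linarith
  also have "\<dots> \<le> 4 * K * \<bar>y - z\<bar>" using K abs_sin_diff_le[of y z] by (intro mult_left_mono) auto
  finally show ?thesis .
qed

lemma speed_periodic: "speed x (y + 2 * pi * of_int k) = speed x y"
proof -
  have "sin (y + 2 * pi * of_int k) = sin y" "cos (y + 2 * pi * of_int k) = cos y"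
    by (simp_all add: sin_add cos_add)
  then show ?thesis by (simp add: speed_def)
qed

lemma phase_exists:
  assumes "0 \<le> s"
  shows "\<exists>\<theta>. \<theta> a = y \<and> phase s \<theta>"
  unfolding phase_def
proof (rule lipschitz_ode_solution_exists)
  show "a < b" by (rule ab)
  show "0 < s * (4 * K) + 1" using assms K by (simp add: add_nonneg_pos)
  show "continuous_on {a..b} (\<lambda>x. s * speed x (g x))" if "continuous_on {a..b} g" for g
    unfolding speed_def by (intro continuous_intros force_continuous that)
  fix x y z assume x: "x \<in> {a..b}"
  have "\<bar>s * speed x y - s * speed x z\<bar> = s * \<bar>speed x y - speed x z\<bar>"
    using assms by (simp add: right_diff_distrib[symmetric] abs_mult)
  also have "\<dots> \<le> s * (4 * K * \<bar>y - z\<bar>)"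
    by (intro mult_left_mono speed_lipschitz x assms)
  also have "\<dots> \<le> (s * (4 * K) + 1) * \<bar>y - z\<bar>" by (simp add: algebra_simps)
  finally show "\<bar>s * speed x y - s * speed x z\<bar> \<le> (s * (4 * K) + 1) * \<bar>y - z\<bar>" .
qed

lemma phase_mono_init:
  assumes "0 \<le> s" "phase s p" "phase s q" "p a \<le> q a" "x \<in> {a..b}"
  shows "p x \<le> q x"
proof (rule differential_inequality_comparison[where p = p and q = q and K = "s * (4 * K)" and a = a and b = b,
      OF phaseD phaseD])
  fix x assume x: "x \<in> {a..b}" "q x < p x"
  have "s * speed x (p x) - s * speed x (q x) \<le> s * (4 * K * \<bar>p x - q x\<bar>)"
    unfolding right_diff_distrib[symmetric] using speed_lipschitz[OF x(1), of "p x" "q x"]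
    by (intro mult_left_mono assms) auto
  then show "s * speed x (p x) - s * speed x (q x) \<le> (s * (4 * K)) * (p x - q x)"
    using x by (simp add: algebra_simps)
qed (use assms in auto)

lemma phase_unique:
  assumes "0 \<le> s" "phase s p" "phase s q" "p a = q a" "x \<in> {a..b}"
  shows "p x = q x"
  using phase_mono_init[OF assms(1,2,3) _ assms(5)] phase_mono_init[OF assms(1,3,2) _ assms(5)] assms(4)
  by simp

lemma phase_shift:
  assumes "phase s \<theta>"
  shows "phase s (\<lambda>x. \<theta> x + 2 * pi * of_int k)"
  using assms unfolding phase_def speed_periodic
  by (auto intro!: derivative_eq_intros)

text \<open>
  Uniform growth in $s$: it yields strict monotonicity of the angle in $x$, and it drives the final
  angle to infinity with $s$.
\<close>
lemma phase_growth:
  assumes "0 \<le> s" "phase s \<theta>" "x \<in> {a..b}" "y \<in> {a..b}" "x \<le> y"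
  shows "\<theta> x + s * \<kappa> * (y - x) \<le> \<theta> y"
proof -
  have "\<theta> x - s * \<kappa> * x \<le> \<theta> y - s * \<kappa> * y"
  proof (rule DERIV_nonneg_imp_increasing_open[where f = "\<lambda>z. \<theta> z - s * \<kappa> * z", OF \<open>x \<le> y\<close>])
    show "continuous_on {x..y} (\<lambda>z. \<theta> z - s * \<kappa> * z)"
      by (intro continuous_intros continuous_on_subset[OF phase_continuous[OF assms(2)]])
         (use assms in auto)
    fix z assume z: "x < z" "z < y"
    then have zab: "z \<in> {a..b}" and z': "a < z" "z < b" using assms by auto
    then have "((\<lambda>z. \<theta> z - s * \<kappa> * z) has_real_derivative s * speed z (\<theta> z) - s * \<kappa>) (at z)"
      using phaseD[OF assms(2) zab] by (auto intro!: derivative_eq_intros simp: at_within_Icc_at)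
    moreover have "0 \<le> s * speed z (\<theta> z) - s * \<kappa>"
      using mult_left_mono[OF speed_bounds(1)[OF zab] assms(1)] by simp
    ultimately show "\<exists>d. ((\<lambda>z. \<theta> z - s * \<kappa> * z) has_real_derivative d) (at z) \<and> 0 \<le> d" by blast
  qed
  then show ?thesis by (simp add: algebra_simps)
qed

text \<open>
  Plain comparison would only give a weak inequality. The barrier $p + \epsilon(x-a)$ is still
  overtaken by the faster flow if $\epsilon$ is small: the surplus $(s_2-s_1)\kappa$ in speed must
  pay for the slope $\epsilon$ and for the Lipschitz error $J\epsilon(b-a)$, which is the equation
  defining \<open>\<epsilon>\<close>.
\<close>
lemma phase_strict_mono_param:
  assumes s: "0 \<le> s1" "s1 < s2" and ph: "phase s1 p" "phase s2 q" and init: "p a = q a"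
  shows "p b < q b"
proof -
  define J where "J = 4 * K * s1"
  have J: "0 \<le> J" using K s by (simp add: J_def)
  define \<epsilon> where "\<epsilon> = (s2 - s1) * \<kappa> / (1 + J * (b - a))"
  have den: "0 < 1 + J * (b - a)" using J ab by (simp add: add_pos_nonneg)
  have eps: "0 < \<epsilon>" using s kappa den by (simp add: \<epsilon>_def)
  have eps_eq: "\<epsilon> + J * (\<epsilon> * (b - a)) = (s2 - s1) * \<kappa>"
  proof -
    have "\<epsilon> + J * (\<epsilon> * (b - a)) = \<epsilon> * (1 + J * (b - a))" by (simp add: algebra_simps)
    then show ?thesis using den by (simp add: \<epsilon>_def)
  qed
  have "p b + \<epsilon> * (b - a) \<le> q b"
  proof (rule differential_inequality_comparison[where p = "\<lambda>x. p x + \<epsilon> * (x - a)" and K = J])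
    show "((\<lambda>x. p x + \<epsilon> * (x - a)) has_real_derivative s1 * speed x (p x) + \<epsilon>) (at x within {a..b})"
      if "x \<in> {a..b}" for x
      using phaseD[OF ph(1) that] by (auto intro!: derivative_eq_intros)
    show "(q has_real_derivative s2 * speed x (q x)) (at x within {a..b})" if "x \<in> {a..b}" for x
      by (rule phaseD[OF ph(2) that])
    fix x assume x: "x \<in> {a..b}" and less: "q x < p x + \<epsilon> * (x - a)"
    have shift: "0 \<le> \<epsilon> * (x - a)" "\<epsilon> * (x - a) \<le> \<epsilon> * (b - a)" using eps x by auto
    have "s1 * (speed x (p x) - speed x (q x)) \<le> s1 * (4 * K * \<bar>p x - q x\<bar>)"
      using speed_lipschitz[OF x, of "p x" "q x"] s by (intro mult_left_mono) auto
    also have "\<dots> = J * \<bar>p x - q x\<bar>" by (simp add: J_def)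
    also have "\<dots> \<le> J * ((p x + \<epsilon> * (x - a) - q x) + \<epsilon> * (b - a))"
      using less shift J by (intro mult_left_mono) auto
    finally have 1: "s1 * (speed x (p x) - speed x (q x)) \<le>
        J * (p x + \<epsilon> * (x - a) - q x) + J * (\<epsilon> * (b - a))" by (simp add: distrib_left)
    have 2: "(s2 - s1) * \<kappa> \<le> (s2 - s1) * speed x (q x)"
      using s by (intro mult_left_mono speed_bounds x) auto
    show "s1 * speed x (p x) + \<epsilon> - s2 * speed x (q x) \<le> J * (p x + \<epsilon> * (x - a) - q x)"
      using 1 2 eps_eq by (simp add: algebra_simps)
  qed (use init ab in auto)
  moreover have "0 < \<epsilon> * (b - a)" using eps ab by simp
  ultimately show ?thesis by linarith
qed

text \<open>
  The barrier is $p + \epsilon(e^{J(x-a)}-1)$. Its extra speed is $J$ times the distance to $p$ plus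
  $J\epsilon = (s_2-s_1)K$, which bounds the effect of changing the parameter.
\<close>
lemma phase_lipschitz_param:
  assumes s: "0 \<le> s1" "s1 \<le> s2" "s2 \<le> S" and ph: "phase s1 p" "phase s2 q" and init: "p a = q a"
    and J: "J = 4 * K * S + 1"
  shows "q b \<le> p b + (s2 - s1) * (K / J * (exp (J * (b - a)) - 1))"
proof -
  have Jpos: "0 < J" using s K by (simp add: J add_nonneg_pos)
  define \<epsilon> where "\<epsilon> = (s2 - s1) * K / J"
  have eps: "0 \<le> \<epsilon>" using s K Jpos by (simp add: \<epsilon>_def)
  have eps_eq: "J * \<epsilon> = (s2 - s1) * K" using Jpos by (simp add: \<epsilon>_def)
  let ?P = "\<lambda>x. p x + \<epsilon> * (exp (J * (x - a)) - 1)"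
  have "q b \<le> ?P b"
  proof (rule differential_inequality_comparison[where q = ?P and K = J])
    show "(?P has_real_derivative s1 * speed x (p x) + J * \<epsilon> * exp (J * (x - a))) (at x within {a..b})"
      if "x \<in> {a..b}" for x
      using phaseD[OF ph(1) that] by (auto intro!: derivative_eq_intros)
    show "(q has_real_derivative s2 * speed x (q x)) (at x within {a..b})" if "x \<in> {a..b}" for x
      by (rule phaseD[OF ph(2) that])
    fix x assume x: "x \<in> {a..b}" and less: "?P x < q x"
    have shift: "0 \<le> \<epsilon> * (exp (J * (x - a)) - 1)" using eps x Jpos by auto
    have "s2 * (speed x (q x) - speed x (p x)) \<le> s2 * (4 * K * \<bar>q x - p x\<bar>)"
      using speed_lipschitz[OF x, of "q x" "p x"] s by (intro mult_left_mono) auto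
    also have "\<dots> = (4 * K * s2) * (q x - p x)" using less shift by simp
    also have "\<dots> \<le> J * (q x - p x)"
    proof (rule mult_right_mono)
      have "4 * K * s2 \<le> 4 * K * S" using s K by (intro mult_left_mono) auto
      then show "4 * K * s2 \<le> J" by (simp add: J)
    qed (use less shift in auto)
    finally have 1: "s2 * (speed x (q x) - speed x (p x)) \<le> J * (q x - p x)" .
    have 2: "(s2 - s1) * speed x (p x) \<le> J * \<epsilon>"
      unfolding eps_eq using s by (intro mult_left_mono speed_bounds x) auto
    show "s2 * speed x (q x) - (s1 * speed x (p x) + J * \<epsilon> * exp (J * (x - a))) \<le> J * (q x - ?P x)"
      using 1 2 by (simp add: algebra_simps)
  qed (use init ab in auto)
  then show ?thesis by (simp add: \<epsilon>_def)
qed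


text \<open>Meaningful for nonnegative $s$, where the solution exists and is unique on the interval.\<close>
definition angle :: "real \<Rightarrow> real \<Rightarrow> real \<Rightarrow> real" where
  "angle s y = (SOME \<theta>. \<theta> a = y \<and> phase s \<theta>)"

lemma
  assumes "0 \<le> s"
  shows angle_init: "angle s y a = y" and phase_angle: "phase s (angle s y)"
  using someI_ex[OF phase_exists[OF assms, of y]] by (auto simp: angle_def)

lemma angle_unique:
  assumes "0 \<le> s" "phase s \<theta>" "\<theta> a = y" "x \<in> {a..b}"
  shows "\<theta> x = angle s y x"
  using phase_unique[OF assms(1,2) phase_angle] angle_init assms by simp

lemma angle_zero_param: "angle 0 y b = y"
  using angle_unique[of 0 "\<lambda>_. y" y b] ab by (auto simp: phase_def)

lemma angle_ge_init: "0 \<le> s \<Longrightarrow> y + s * \<kappa> * (b - a) \<le> angle s y b"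
  using phase_growth[OF _ phase_angle[of s y], of a b] ab angle_init by auto

lemma angle_strict_mono_param:
  "0 \<le> s1 \<Longrightarrow> s1 < s2 \<Longrightarrow> angle s1 y b < angle s2 y b"
  using phase_strict_mono_param[OF _ _ phase_angle phase_angle] angle_init by simp

lemma angle_mono_param_iff:
  "0 \<le> s1 \<Longrightarrow> 0 \<le> s2 \<Longrightarrow> angle s1 y b \<le> angle s2 y b \<longleftrightarrow> s1 \<le> s2"
  using angle_strict_mono_param[of s1 s2 y] angle_strict_mono_param[of s2 s1 y]
  by (cases s1 s2 rule: linorder_cases) auto

lemma angle_continuous_param: "continuous_on {0..S} (\<lambda>s. angle s y b)"
proof -
  define J where "J = 4 * K * S + 1"
  define C where "C = \<bar>K / J * (exp (J * (b - a)) - 1)\<bar>"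
  have *: "\<bar>angle s2 y b - angle s1 y b\<bar> \<le> C * \<bar>s2 - s1\<bar>" if s: "0 \<le> s1" "s1 \<le> s2" "s2 \<le> S" for s1 s2
  proof -
    have "angle s2 y b \<le> angle s1 y b + (s2 - s1) * (K / J * (exp (J * (b - a)) - 1))"
      by (rule phase_lipschitz_param[OF s phase_angle phase_angle _ J_def]) (use s angle_init in auto)
    also have "\<dots> \<le> angle s1 y b + (s2 - s1) * C"
      unfolding C_def using s by (intro add_left_mono mult_left_mono abs_ge_self) auto
    finally show ?thesis using s angle_mono_param_iff[of s1 s2 y] by (simp add: mult.commute)
  qed
  have "C-lipschitz_on {0..S} (\<lambda>s. angle s y b)"
  proof (rule lipschitz_onI)
    fix s1 s2 assume "s1 \<in> {0..S}" "s2 \<in> {0..S}"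
    then show "dist (angle s1 y b) (angle s2 y b) \<le> C * dist s1 s2"
      using *[of s1 s2] *[of s2 s1]
      by (cases "s1 \<le> s2") (auto simp: dist_real_def abs_minus_commute)
  qed (simp add: C_def)
  then show ?thesis by (rule lipschitz_on_continuous_on)
qed

lemma angle_attains:
  assumes "y < v"
  shows "\<exists>s>0. angle s y b = v"
proof -
  define S where "S = (v - y) / (\<kappa> * (b - a))"
  have S: "0 \<le> S" "S * \<kappa> * (b - a) = v - y" using assms kappa ab by (auto simp: S_def)
  then have "v \<le> angle S y b" using angle_ge_init[of S y] by simp
  then obtain s where "0 \<le> s" "angle s y b = v"
    using IVT'[of "\<lambda>s. angle s y b" 0 v S] S angle_continuous_param assms angle_zero_param by auto
  moreover have "s \<noteq> 0" using calculation assms angle_zero_param by auto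
  ultimately show ?thesis by (intro exI[of _ s]) auto
qed

section \<open>Half-eigenvalues through the angle\<close>

text \<open>
  The boundary value problem without its boundary conditions, so that it can serve as an initial
  value problem.
\<close>
definition second_order :: "real \<Rightarrow> (real \<Rightarrow> real) \<Rightarrow> (real \<Rightarrow> real) \<Rightarrow> bool" where
  "second_order l u du \<longleftrightarrow>
     (\<forall>x\<in>{a..b}. (u has_real_derivative du x) (at x within {a..b})) \<and>
     continuous_on {a..b} du \<and>
     (\<forall>x\<in>{a<..<b}. (du has_real_derivative - (l * force x (u x))) (at x))"

lemma bvp_solution_iff:
  "bvp_solution m n t l a b u du \<longleftrightarrow> second_order l u du \<and> u a = 0 \<and> u b = 0"
  by (auto simp: bvp_solution_def second_order_def force_def)

text \<open>
  Uniqueness for the initial value problem, by Gronwall's inequality for the squared distance in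
  the phase plane. It lets every eigenfunction be compared with the one built from an angle, so a
  continuous angle never has to be lifted from a given solution.
\<close>
lemma second_order_unique:
  assumes l: "0 \<le> l" and sol: "second_order l u du" "second_order l v dv"
    and init: "u a = v a" "du a = dv a" and x: "x \<in> {a..b}"
  shows "u x = v x" "du x = dv x"
proof -
  define E where "E = (\<lambda>y. (u y - v y)\<^sup>2 + (du y - dv y)\<^sup>2)"
  define C where "C = 1 + l * K"
  have cont: "continuous_on {a..b} u" "continuous_on {a..b} v" "continuous_on {a..b} du" "continuous_on {a..b} dv"
    using sol by (auto simp: second_order_def intro: DERIV_continuous_on)
  have E_cont: "continuous_on {a..b} E" unfolding E_def by (intro continuous_intros cont)
  have "exp (- C * x) * E x \<le> exp (- C * a) * E a"
  proof (rule DERIV_nonpos_imp_decreasing_open[where f = "\<lambda>y. exp (- C * y) * E y"])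
    show "a \<le> x" using x by simp
    show "continuous_on {a..x} (\<lambda>y. exp (- C * y) * E y)"
      by (intro continuous_intros continuous_on_subset[OF E_cont]) (use x in auto)
    fix y assume y: "a < y" "y < x"
    then have yab: "a < y" "y < b" "y \<in> {a..b}" using x by auto
    let ?p = "u y - v y" and ?q = "du y - dv y" and ?f = "force y (u y) - force y (v y)"
    have d1: "(u has_real_derivative du y) (at y)" "(v has_real_derivative dv y) (at y)"
      using sol yab(3) unfolding second_order_def at_within_Icc_at[OF yab(1,2), symmetric] by blast+
    have d2: "(du has_real_derivative - (l * force y (u y))) (at y)"
      "(dv has_real_derivative - (l * force y (v y))) (at y)"
      using sol yab by (auto simp: second_order_def)
    have "((\<lambda>y. exp (- C * y) * E y) has_real_derivative
        exp (- C * y) * (2 * ?p * ?q - 2 * l * (?q * ?f) - C * E y)) (at y)"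
      unfolding E_def
      by (auto intro!: derivative_eq_intros d1 d2 simp: algebra_simps)
    moreover have "2 * ?p * ?q - 2 * l * (?q * ?f) - C * E y \<le> 0"
    proof -
      have pq: "2 * (\<bar>?q\<bar> * \<bar>?p\<bar>) \<le> E y"
        using zero_le_power2[of "\<bar>?p\<bar> - \<bar>?q\<bar>"] by (simp add: E_def power2_diff algebra_simps)
      have "- (?q * ?f) \<le> \<bar>?q\<bar> * \<bar>?f\<bar>" by (metis abs_ge_minus_self abs_mult)
      also have "\<dots> \<le> \<bar>?q\<bar> * (K * \<bar>?p\<bar>)" by (intro mult_left_mono force_lipschitz yab) auto
      finally have "2 * l * - (?q * ?f) \<le> 2 * l * (\<bar>?q\<bar> * (K * \<bar>?p\<bar>))" using l by (intro mult_left_mono) auto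
      also have "\<dots> = l * K * (2 * (\<bar>?q\<bar> * \<bar>?p\<bar>))" by simp
      also have "\<dots> \<le> l * K * E y" using l K by (intro mult_left_mono pq) auto
      finally have 1: "- (2 * l * (?q * ?f)) \<le> l * K * E y" by simp
      have "2 * ?p * ?q \<le> E y"
        using zero_le_power2[of "?p - ?q"] by (simp add: E_def power2_diff)
      then show ?thesis using 1 by (simp add: C_def algebra_simps)
    qed
    ultimately show "\<exists>d. ((\<lambda>y. exp (- C * y) * E y) has_real_derivative d) (at y) \<and> d \<le> 0"
      by (meson exp_ge_zero mult_nonneg_nonpos)
  qed
  then have "E x \<le> 0" using init by (simp add: E_def mult_le_0_iff)
  moreover have "0 \<le> (u x - v x)\<^sup>2" "0 \<le> (du x - dv x)\<^sup>2" by simp_all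
  ultimately have "(u x - v x)\<^sup>2 = 0" "(du x - dv x)\<^sup>2 = 0" unfolding E_def by linarith+
  then show "u x = v x" "du x = dv x" by auto
qed

text \<open>
  Given the angle, the amplitude solves the linear equation
  $r' = r\,s\cos\theta\,(\sin\theta - f(x,\sin\theta))$, so it is an exponential and never vanishes.
  Only nonnegative multiples are solutions again, because the problem is merely positively
  homogeneous.
\<close>
lemma polar_solution_exists:
  assumes s: "0 \<le> s" and ph: "phase s \<theta>"
  shows "\<exists>r. r a = 1 \<and> (\<forall>x. 0 < r x) \<and>
           (\<forall>c\<ge>0. second_order (s\<^sup>2) (\<lambda>x. c * (r x * sin (\<theta> x))) (\<lambda>x. c * (s * (r x * cos (\<theta> x)))))"
proof -
  define g where "g = (\<lambda>x. s * cos (\<theta> x) * (sin (\<theta> x) - force x (sin (\<theta> x))))"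
  have g_cont: "continuous_on {a..b} g"
    unfolding g_def by (intro continuous_intros force_continuous phase_continuous[OF ph])
  define r where "r = (\<lambda>x. exp (integral {a..x} g))"
  have dr: "(r has_real_derivative r x * g x) (at x within {a..b})" if "x \<in> {a..b}" for x
    unfolding r_def using integral_has_real_derivative[OF g_cont that]
    by (auto intro!: derivative_eq_intros)
  have r_cont: "continuous_on {a..b} r" using dr by (rule DERIV_continuous_on)
  have sol: "second_order (s\<^sup>2) (\<lambda>x. c * (r x * sin (\<theta> x))) (\<lambda>x. c * (s * (r x * cos (\<theta> x))))"
    if c: "0 \<le> c" for c
    unfolding second_order_def
  proof (intro conjI ballI)
    show "continuous_on {a..b} (\<lambda>x. c * (s * (r x * cos (\<theta> x))))"
      by (intro continuous_intros r_cont phase_continuous[OF ph])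
  next
    fix x assume x: "x \<in> {a..b}"
    let ?S = "sin (\<theta> x)" and ?C = "cos (\<theta> x)"
    let ?f = "force x ?S"
    have "((\<lambda>x. c * (r x * sin (\<theta> x))) has_real_derivative
        c * (r x * g x * ?S + r x * (?C * (s * speed x (\<theta> x))))) (at x within {a..b})"
      by (auto intro!: derivative_eq_intros dr[OF x] phaseD[OF ph x])
    moreover have "g x * ?S + ?C * (s * speed x (\<theta> x)) = s * ?C * (?S\<^sup>2 + ?C\<^sup>2)"
      unfolding g_def speed_def by algebra
    then have "g x * ?S + ?C * (s * speed x (\<theta> x)) = s * ?C" by simp
    then have "c * (r x * g x * ?S + r x * (?C * (s * speed x (\<theta> x)))) = c * (s * (r x * ?C))"
      by (metis (no_types, lifting) distrib_left mult.assoc mult.left_commute)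
    ultimately show "((\<lambda>x. c * (r x * sin (\<theta> x))) has_real_derivative c * (s * (r x * ?C))) (at x within {a..b})"
      by simp
  next
    fix x assume x: "x \<in> {a<..<b}"
    then have xab: "x \<in> {a..b}" by auto
    let ?S = "sin (\<theta> x)" and ?C = "cos (\<theta> x)"
    let ?f = "force x ?S"
    have "((\<lambda>x. c * (s * (r x * cos (\<theta> x)))) has_real_derivative
        c * (s * (r x * g x * ?C - r x * (?S * (s * speed x (\<theta> x)))))) (at x within {a..b})"
      by (auto intro!: derivative_eq_intros dr[OF xab] phaseD[OF ph xab])
    moreover have "g x * ?C - ?S * (s * speed x (\<theta> x)) = - s * ?f * (?S\<^sup>2 + ?C\<^sup>2)"
      unfolding g_def speed_def by algebra
    then have "g x * ?C - ?S * (s * speed x (\<theta> x)) = - s * ?f" by simp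
    then have "r x * (g x * ?C - ?S * (s * speed x (\<theta> x))) = r x * (- s * ?f)" by simp
    then have "c * (s * (r x * g x * ?C - r x * (?S * (s * speed x (\<theta> x))))) = - (s\<^sup>2 * ((c * r x) * ?f))"
      by (simp add: right_diff_distrib mult.assoc power2_eq_square mult.left_commute[of c])
    moreover have "(c * r x) * ?f = force x (c * (r x * ?S))"
      using force_scale[of "c * r x" x ?S] c by (simp add: r_def mult.assoc)
    ultimately show "((\<lambda>x. c * (s * (r x * cos (\<theta> x)))) has_real_derivative
        - (s\<^sup>2 * force x (c * (r x * ?S)))) (at x)"
      using x by (simp add: at_within_Icc_at)
  qed
  show ?thesis by (intro exI[of _ r]) (auto simp: r_def sol[unfolded r_def])
qed

lemma phase_strict_mono:
  assumes "0 < s" "phase s \<theta>"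
  shows "strict_mono_on {a..b} \<theta>"
proof (rule strict_mono_onI)
  fix x y assume xy: "x \<in> {a..b}" "y \<in> {a..b}" "x < y"
  then have "0 < s * \<kappa> * (y - x)" using assms kappa by simp
  then show "\<theta> x < \<theta> y" using phase_growth[of s \<theta> x y] assms xy by simp
qed

text \<open>
  The sign of the initial slope is encoded by the starting angle $y$: for $y = 0$ and $y = \pi$ the
  factor $\cos y$ is $1$ and $-1$. This treats both families of half-eigenvalues at once.
\<close>
lemma half_eigenfunction_iff:
  assumes s: "0 < s" and y: "sin y = 0" and k: "1 \<le> k"
  shows "(\<exists>u du. bvp_solution m n t (s\<^sup>2) a b u du \<and> (\<exists>x\<in>{a..b}. u x \<noteq> 0) \<and>
            card (nodal_domains a b u) = k \<and> 0 < cos y * du a)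
         \<longleftrightarrow> angle s y b = y + real k * pi" (is "?L \<longleftrightarrow> ?R")
proof -
  define \<theta> where "\<theta> = angle s y"
  have th: "phase s \<theta>" "\<theta> a = y" using s phase_angle angle_init by (auto simp: \<theta>_def)
  have mono: "strict_mono_on {a..b} \<theta>" by (rule phase_strict_mono[OF s th(1)])
  obtain r where r: "r a = 1" "\<And>x. 0 < r x"
    and sol: "\<And>c. 0 \<le> c \<Longrightarrow> second_order (s\<^sup>2) (\<lambda>x. c * (r x * sin (\<theta> x))) (\<lambda>x. c * (s * (r x * cos (\<theta> x))))"
    using polar_solution_exists[OF _ th(1)] s by auto
  have cos_sq: "cos y * cos y = 1" using sin_cos_squared_add[of y] y by (simp add: power2_eq_square)
  have card_eq: "card (nodal_domains a b u) = k'"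
    if "\<theta> b = y + real k' * pi" "\<And>x. x \<in> {a..b} \<Longrightarrow> u x = 0 \<longleftrightarrow> sin (\<theta> x) = 0" for u k'
    by (rule card_nodal_domains_angle[OF ab phase_continuous[OF th(1)] mono]) (use that th y in auto)
  show ?thesis
  proof
    assume R: ?R
    define u where "u = (\<lambda>x. 1 * (r x * sin (\<theta> x)))"
    define du where "du = (\<lambda>x. 1 * (s * (r x * cos (\<theta> x))))"
    have "sin (\<theta> b) = 0" using R y by (simp add: \<theta>_def sin_add)
    then have bvp: "bvp_solution m n t (s\<^sup>2) a b u du"
      unfolding bvp_solution_iff u_def du_def using sol[of 1] th y by simp
    have card: "card (nodal_domains a b u) = k"
      using R r(2) by (intro card_eq) (auto simp: u_def \<theta>_def less_imp_neq[symmetric] dest: less_imp_neq)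
    have "nodal_domains a b u \<noteq> {}" using card k by (metis card.empty not_one_le_zero)
    then have "{x \<in> {a<..<b}. u x \<noteq> 0} \<noteq> {}" unfolding nodal_domains_def by (metis components_empty)
    then have "\<exists>x\<in>{a..b}. u x \<noteq> 0" by force
    moreover have "cos y * du a = s * (cos y * cos y)" using r th by (simp add: du_def)
    then have "0 < cos y * du a" using s by (simp add: cos_sq)
    ultimately show ?L using bvp card by blast
  next
    assume ?L
    then obtain u du where bvp: "bvp_solution m n t (s\<^sup>2) a b u du"
      and card: "card (nodal_domains a b u) = k" and slope: "0 < cos y * du a" by blast
    \<comment> \<open>The multiple of the polar solution that has the same initial slope as $u$.\<close>
    define c where "c = cos y * du a / s"
    have c: "0 < c" using slope s by (simp add: c_def)
    have "c * s * cos y = cos y * cos y * du a" using s by (simp add: c_def)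
    then have slope_eq: "du a = c * (s * (r a * cos (\<theta> a)))" by (simp add: cos_sq r th)
    have u_eq: "u x = c * (r x * sin (\<theta> x))" if "x \<in> {a..b}" for x
    proof (rule second_order_unique(1)[OF _ _ sol])
      show "second_order (s\<^sup>2) u du" "u a = c * (r a * sin (\<theta> a))"
        using bvp y th by (auto simp: bvp_solution_iff)
    qed (use c slope_eq that in auto)
    have zeros: "u x = 0 \<longleftrightarrow> sin (\<theta> x) = 0" if "x \<in> {a..b}" for x
      using u_eq[OF that] c r(2)[of x] by auto
    have "sin (\<theta> b) = 0" using zeros[of b] bvp ab by (auto simp: bvp_solution_iff)
    then obtain i j where ij: "\<theta> b = of_int i * pi" "y = of_int j * pi"
      using y by (auto simp: sin_zero_iff_int2)
    have "y < \<theta> b" using mono ab th by (auto simp: strict_mono_on_def)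
    then have "j < i" unfolding ij using mult_less_cancel_right_pos[OF pi_gt_zero] of_int_less_iff by blast
    then have eq: "\<theta> b = y + real (nat (i - j)) * pi" by (simp add: ij algebra_simps)
    then have "nat (i - j) = k" using card card_eq zeros by metis
    then show ?R using eq by (simp add: \<theta>_def)
  qed
qed

text \<open>
  The final angle is a strictly increasing function of $\sqrt l$ that attains every value above
  $y$. So the description has a unique solution, and its comparison with $l$ becomes a comparison
  of final angles.
\<close>
lemma half_eigenvalue_le_iff:
  assumes k: "1 \<le> k" and l: "0 \<le> l" and y: "sin y = 0"
  shows "(THE l. 0 < l \<and> (\<exists>u du. bvp_solution m n t l a b u du \<and> (\<exists>x\<in>{a..b}. u x \<noteq> 0) \<and>
            card (nodal_domains a b u) = k \<and> 0 < cos y * du a)) \<le> l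
         \<longleftrightarrow> y + real k * pi \<le> angle (sqrt l) y b" (is "(THE l. ?P l) \<le> l \<longleftrightarrow> _")
proof -
  have P: "?P l \<longleftrightarrow> 0 < l \<and> angle (sqrt l) y b = y + real k * pi" for l
    using half_eigenfunction_iff[of "sqrt l", OF _ y k] by auto
  have "y < y + real k * pi" using k pi_gt_zero by simp
  then obtain s where s: "0 < s" "angle s y b = y + real k * pi" using angle_attains by blast
  have "(THE l. ?P l) = s\<^sup>2"
  proof (rule the_equality)
    show "?P (s\<^sup>2)" unfolding P using s by simp
    fix l' assume "?P l'"
    then have "0 < l'" "angle (sqrt l') y b = angle s y b" unfolding P using s by auto
    then have "sqrt l' = s"
      using angle_mono_param_iff[of "sqrt l'" s y] angle_mono_param_iff[of s "sqrt l'" y] s by auto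
    then show "l' = s\<^sup>2" using \<open>0 < l'\<close> by auto
  qed
  moreover have "s\<^sup>2 \<le> l \<longleftrightarrow> s \<le> sqrt l" using s l
    by (metis less_eq_real_def real_le_rsqrt real_sqrt_le_iff real_sqrt_unique)
  ultimately show ?thesis using angle_mono_param_iff[of s "sqrt l" y] s l by simp
qed

lemma card_multiples_below:
  assumes "0 \<le> z"
  shows "card {k::nat. 1 \<le> k \<and> real k * pi \<le> z} = nat \<lfloor>z / pi\<rfloor>"
proof -
  have "{k::nat. 1 \<le> k \<and> real k * pi \<le> z} = {1..nat \<lfloor>z / pi\<rfloor>}"
    using assms by (auto simp: le_nat_iff le_floor_iff pos_le_divide_eq)
  then show ?thesis by simp
qed

definition half_turns :: "real \<Rightarrow> real \<Rightarrow> nat" where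
  "half_turns s y = nat \<lfloor>(angle s y b - y) / pi\<rfloor>"

lemma spectral_count_eq:
  assumes l: "0 \<le> l"
  shows "spectral_count m n l t a b = half_turns (sqrt l) 0 + half_turns (sqrt l) pi"
proof -
  have ge: "0 \<le> angle (sqrt l) y b - y" for y
  proof -
    have "0 \<le> sqrt l * \<kappa> * (b - a)" using l kappa ab by simp
    then show ?thesis using angle_ge_init[of "sqrt l" y] l by simp
  qed
  have "{k. 1 \<le> k \<and> eigval_pos m n t a b k \<le> l} = {k. 1 \<le> k \<and> real k * pi \<le> angle (sqrt l) 0 b - 0}"
    unfolding eigval_pos_def using half_eigenvalue_le_iff[OF _ l, of _ 0] by auto
  moreover have "{k. 1 \<le> k \<and> eigval_neg m n t a b k \<le> l} = {k. 1 \<le> k \<and> real k * pi \<le> angle (sqrt l) pi b - pi}"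
    unfolding eigval_neg_def using half_eigenvalue_le_iff[OF _ l, of _ pi] by (auto simp: algebra_simps)
  ultimately show ?thesis
    unfolding spectral_count_def half_turns_def using card_multiples_below[OF ge] by presburger
qed

end

section \<open>Cutting the interval\<close>

text \<open>
  On the right part, the angle $\theta$ coming from the left is squeezed between
  $\phi + 2\pi i$ and $\phi + 2\pi(i+1)$, where $\phi$ starts afresh at $y$ and $i$ counts the full
  turns made on the left part. The angles therefore add up to within $2\pi$, that is two half turns,
  and rounding down three times changes the count by less than two more.
\<close>
lemma half_turns_additive:
  assumes W: "half_linear m n t a b \<kappa> K" and A: "half_linear m n t a c \<kappa> K"
    and B: "half_linear m n t c b \<kappa> K" and s: "0 \<le> s"
  shows "\<bar>real (half_linear.half_turns m n t a b s y) - (real (half_linear.half_turns m n t a c s y)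
           + real (half_linear.half_turns m n t c b s y))\<bar> \<le> 4"
proof -
  interpret W: half_linear m n t a b \<kappa> K by (rule W)
  interpret A: half_linear m n t a c \<kappa> K by (rule A)
  interpret B: half_linear m n t c b \<kappa> K by (rule B)
  define \<theta> where "\<theta> = W.angle s y"
  define \<phi> where "\<phi> = B.angle s y"
  have th: "W.phase s \<theta>" "\<theta> a = y" using s W.phase_angle W.angle_init by (auto simp: \<theta>_def)
  have thA: "A.phase s \<theta>"
    unfolding A.phase_def using A.ab B.ab
    by (auto intro: has_field_derivative_subset[OF W.phaseD[OF th(1)]])
  have thB: "B.phase s \<theta>"
    unfolding B.phase_def using A.ab B.ab
    by (auto intro: has_field_derivative_subset[OF W.phaseD[OF th(1)]])
  have ph: "B.phase s \<phi>" "\<phi> c = y" using s B.phase_angle B.angle_init by (auto simp: \<phi>_def)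
  have A_angle: "A.angle s y c = \<theta> c"
    using A.angle_unique[OF s thA th(2), of c] A.ab by simp
  define d where "d = \<theta> c - y"
  have d0: "0 \<le> d" and e0: "0 \<le> \<phi> b - y" and f0: "0 \<le> \<theta> b - y"
  proof -
    have "0 \<le> s * \<kappa> * (c - a)" "0 \<le> s * \<kappa> * (b - c)" "0 \<le> s * \<kappa> * (b - a)"
      using s A.kappa A.ab B.ab W.ab by simp_all
    then show "0 \<le> d" "0 \<le> \<phi> b - y" "0 \<le> \<theta> b - y"
      using A.angle_ge_init[OF s, of y] B.angle_ge_init[OF s, of y] W.angle_ge_init[OF s, of y] A_angle
      by (auto simp: d_def \<phi>_def \<theta>_def)
  qed
  define i where "i = \<lfloor>d / (2 * pi)\<rfloor>"
  have "of_int i \<le> d / (2 * pi)" "d / (2 * pi) < of_int (i + 1)" unfolding i_def by linarith+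
  then have i: "2 * pi * of_int i \<le> d" "d < 2 * pi * of_int (i + 1)"
    using pi_gt_zero by (simp_all add: field_simps)
  have "\<phi> b + 2 * pi * of_int i \<le> \<theta> b"
    using B.phase_mono_init[OF s B.phase_shift[OF ph(1)] thB, of i b] i ph(2) B.ab by (simp add: d_def)
  moreover have "\<theta> b \<le> \<phi> b + 2 * pi * of_int (i + 1)"
    using B.phase_mono_init[OF s thB B.phase_shift[OF ph(1)], of "i + 1" b] i ph(2) B.ab
    by (simp add: d_def)
  ultimately have close: "\<bar>(\<theta> b - y) - d - (\<phi> b - y)\<bar> \<le> 2 * pi"
    using i by (simp add: algebra_simps)
  define X Y Z where "X = (\<theta> b - y) / pi" and "Y = d / pi" and "Z = (\<phi> b - y) / pi"
  have nonneg: "0 \<le> X" "0 \<le> Y" "0 \<le> Z" using d0 e0 f0 by (auto simp: X_def Y_def Z_def)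
  have "X - Y - Z = ((\<theta> b - y) - d - (\<phi> b - y)) / pi"
    by (simp only: X_def Y_def Z_def diff_divide_distrib)
  then have XYZ: "\<bar>X - Y - Z\<bar> \<le> 2" using close by (simp add: divide_le_eq)
  have "W.half_turns s y = nat \<lfloor>X\<rfloor>" "A.half_turns s y = nat \<lfloor>Y\<rfloor>" "B.half_turns s y = nat \<lfloor>Z\<rfloor>"
    by (simp_all add: W.half_turns_def A.half_turns_def B.half_turns_def A_angle X_def Y_def Z_def d_def \<theta>_def \<phi>_def)
  then show ?thesis using nonneg XYZ by simp linarith
qed

theorem theorem1p5:
  fixes L c t :: real and m n :: "real \<Rightarrow> real"
  assumes "L > 0"
    and "continuous_on {0..L} m" and "continuous_on {0..L} n"
    and "\<exists>\<delta>>0. \<forall>x\<in>{0..L}. \<delta> \<le> m x \<and> \<delta> \<le> n x"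
    and "c \<in> {0<..<L}"
    and "t > 0"
  shows "(\<lambda>l. real (spectral_count m n l t 0 L)
              - (real (spectral_count m n l t 0 c) + real (spectral_count m n l t c L)))
           \<in> O[at_top](\<lambda>_. 1)"
proof -
  obtain \<delta> where \<delta>: "0 < \<delta>" "\<And>x. x \<in> {0..L} \<Longrightarrow> \<delta> \<le> m x" "\<And>x. x \<in> {0..L} \<Longrightarrow> \<delta> \<le> n x"
    using assms(4) by blast
  define \<kappa> where "\<kappa> = min 1 (min \<delta> (t * \<delta>))"
  obtain M1 where M1: "\<And>x. x \<in> {0..L} \<Longrightarrow> m x \<le> M1"
    using continuous_attains_sup[OF compact_Icc _ assms(2)] assms(1) by fastforce
  obtain M2 where M2: "\<And>x. x \<in> {0..L} \<Longrightarrow> n x \<le> M2"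
    using continuous_attains_sup[OF compact_Icc _ assms(3)] assms(1) by fastforce
  define K where "K = max 1 (max M1 (t * M2))"
  have hl: "half_linear m n t a b \<kappa> K" if "0 \<le> a" "a < b" "b \<le> L" for a b
  proof
    show "continuous_on {a..b} m" "continuous_on {a..b} n"
      using that by (auto intro: continuous_on_subset[OF assms(2)] continuous_on_subset[OF assms(3)])
    show "0 < \<kappa>" "\<kappa> \<le> 1" "1 \<le> K" using \<delta> \<open>t > 0\<close> by (auto simp: \<kappa>_def K_def)
    fix x assume "x \<in> {a..b}"
    then have x: "x \<in> {0..L}" using that by auto
    have "t * \<delta> \<le> t * n x" "t * n x \<le> t * M2"
      using \<delta>(3)[OF x] M2[OF x] \<open>t > 0\<close> by (auto intro!: mult_left_mono)
    then show "\<kappa> \<le> m x" "\<kappa> \<le> t * n x" "m x \<le> K" "t * n x \<le> K"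
      using \<delta>(2)[OF x] M1[OF x] by (auto simp: \<kappa>_def K_def)
  qed (use that in auto)
  have W: "half_linear m n t 0 L \<kappa> K" and A: "half_linear m n t 0 c \<kappa> K" and B: "half_linear m n t c L \<kappa> K"
    using hl assms(1,5) by auto
  show ?thesis
  proof (rule bigoI[where c = 8])
    show "\<forall>\<^sub>F l in at_top. norm (real (spectral_count m n l t 0 L)
              - (real (spectral_count m n l t 0 c) + real (spectral_count m n l t c L))) \<le> 8 * norm (1::real)"
      using eventually_ge_at_top[of 0]
    proof eventually_elim
      case (elim l)
      then show ?case
        using half_turns_additive[OF W A B, of "sqrt l" 0] half_turns_additive[OF W A B, of "sqrt l" pi]
          half_linear.spectral_count_eq[OF W elim] half_linear.spectral_count_eq[OF A elim]
          half_linear.spectral_count_eq[OF B elim] by simp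
    qed
  qed
qed

end
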